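(* For integers $n>1$ and $x\in\mathbb{R}$ let $$s(n,x)=\sum_{k=1}^{n}\sin^2\!\left(\frac{x\,\Gamma(k)}{k}\right),$$ and let $\Pi(n)$ be the number of primes $p\le n$. Then: (i) For Lebesgue-almost every $x\in\mathbb{R}$ one has $s(n,x)\sim \frac n2$ as $n\to\infty$, i.e. $\frac{s(n,x)}{n}\to\frac12$. (ii) There is a subset of $\mathbb{R}$ which is a dense countable intersection of open sets such that for every $x$ in it, $\frac12$ is a limit point of the sequence $\left(\frac{s(n,x)}{\Pi(n)}\right)_{n}$, i.e. $\liminf_{n\to\infty}\left|\frac{s(n,x)}{\Pi(n)}-\frac12\right|=0$.
   Context: $\Gamma(k)=(k-1)!$ for positive integers $k$. *)

theory Defs
  imports "HOL-Analysis.Analysis" "HOL-Computational_Algebra.Primes"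
    "HOL-Library.Landau_Symbols"
begin

definition s :: "nat \<Rightarrow> real \<Rightarrow> real" where
  "s n x = (\<Sum>k=1..n. (sin (x * Gamma (real k) / real k))\<^sup>2)"

lemma Gamma_real_eq_fact: "k \<ge> 1 \<Longrightarrow> Gamma (real k) = fact (k - 1)"
  by (cases k) (simp_all only: of_nat_Suc Gamma_fact, simp_all)

definition prime_count :: "nat \<Rightarrow> nat" where
  "prime_count n = card {p. prime p \<and> p \<le> n}"

end

(*
For (i), write sin^2 y = (1 - cos 2y) / 2. The frequencies Gamma k / k separate so fast that the
functions cos (2 x Gamma k / k) are nearly orthogonal on every bounded interval. Hence the square
integral of their n-th partial sum is O(n), the means along n = m^2 are square summable almost
everywhere, and they tend to 0; the means in between are controlled by |cos| <= 1.

For (ii), let x run through M consecutive multiples of pi / L! inside a given interval. If k is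
composite and k >= 2 L + 16, then k L! divides (k - 1)!, so the k-th term vanishes at all these
points. If k is prime, the phase advances by a fraction of pi with denominator exactly k, so the
geometric sum of the cosines is at most k. With n = 4^(K L) we have n / M -> 0 as L grows, while
Erdos' count of squarefree parts gives at least K L primes up to n; so s(n, x) / Pi(n) is on
average close to 1/2. By the intermediate value theorem it is close to 1/2 at some point of the
interval, and Baire's theorem concludes.
*)
theory Submission
  imports Defs "HOL-Library.Discrete_Functions" "HOL-Computational_Algebra.Squarefree"
begin

section \<open>Mean squares of cosine sums with separated frequencies\<close>

lemma integral_cos_symmetric:
  fixes e R :: real
  assumes "e \<noteq> 0" "R \<ge> 0"
  shows "\<bar>integral {-R..R} (\<lambda>x. cos (e * x))\<bar> \<le> 2 / \<bar>e\<bar>"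
proof -
  have "((\<lambda>x. cos (e * x)) has_integral (sin (e * R) / e - sin (e * (-R)) / e)) {-R..R}"
    by (rule fundamental_theorem_of_calculus)
       (use assms in \<open>auto intro!: derivative_eq_intros
          simp: has_real_derivative_iff_has_vector_derivative[symmetric]\<close>)
  then have "integral {-R..R} (\<lambda>x. cos (e * x)) = 2 * sin (e * R) / e"
    by (simp add: integral_unique)
  then show ?thesis
    using assms by (simp add: abs_mult divide_right_mono)
qed

text \<open>The product is the mean of the cosines with frequencies \<open>a - b\<close> and
  \<open>a + b\<close>. As \<open>a\<close> and \<open>b\<close> are nonnegative,
  \<open>a + b\<close> is also at least \<open>d\<close>, so each integral is at most
  \<open>2 / d\<close>, uniformly in \<open>R\<close>.\<close>

lemma integral_cos_times_cos:
  fixes a b d R :: real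
  assumes "0 \<le> a" "0 \<le> b" "d > 0" "d \<le> \<bar>a - b\<bar>" "R \<ge> 0"
  shows "\<bar>integral {-R..R} (\<lambda>x. cos (a * x) * cos (b * x))\<bar> \<le> 2 / d"
proof -
  have ne: "a - b \<noteq> 0" "a + b \<noteq> 0" using assms by auto
  have eq: "cos (a * x) * cos (b * x) = cos ((a - b) * x) / 2 + cos ((a + b) * x) / 2" for x
    by (simp add: cos_times_cos algebra_simps)
  have "integral {-R..R} (\<lambda>x. cos (a * x) * cos (b * x)) =
      integral {-R..R} (\<lambda>x. cos ((a - b) * x)) / 2 + integral {-R..R} (\<lambda>x. cos ((a + b) * x)) / 2"
    unfolding eq
    by (subst integral_add) (auto intro!: integrable_continuous_real continuous_intros)
  also have "\<bar>\<dots>\<bar> \<le> (2 / \<bar>a - b\<bar>) / 2 + (2 / \<bar>a + b\<bar>) / 2"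
    using integral_cos_symmetric[OF ne(1) assms(5)] integral_cos_symmetric[OF ne(2) assms(5)]
    by (intro order_trans[OF abs_triangle_ineq] add_mono) auto
  also have "\<dots> \<le> (2 / d) / 2 + (2 / d) / 2"
    by (intro add_mono divide_right_mono divide_left_mono) (use assms in auto)
  finally show ?thesis by simp
qed

text \<open>When the term \<open>Suc n\<close> is added, each of the \<open>n\<close> cross terms is
  at most \<open>2 / (c * (n + 1))\<close>, because the required gap grows linearly with the larger
  index. Together they stay below \<open>2 / c\<close>, doubled by the binomial formula, and the new
  square adds at most \<open>2 * R\<close>.\<close>

lemma integral_cos_sum_square:
  fixes w :: "nat \<Rightarrow> real" and c R :: real
  assumes nonneg: "\<And>k. 1 \<le> k \<Longrightarrow> 0 \<le> w k"
    and sep: "\<And>j k. 1 \<le> j \<Longrightarrow> j < k \<Longrightarrow> c * real k \<le> \<bar>w k - w j\<bar>"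
    and "c > 0" "R \<ge> 0"
  shows "integral {-R..R} (\<lambda>x. (\<Sum>k=1..n. cos (w k * x))\<^sup>2) \<le> (2 * R + 4 / c) * real n"
proof (induction n)
  case 0
  then show ?case by simp
next
  case (Suc n)
  let ?g = "\<lambda>x. \<Sum>k=1..n. cos (w k * x)"
  let ?f = "\<lambda>x. cos (w (Suc n) * x)"
  have "integral {-R..R} (\<lambda>x. (\<Sum>k=1..Suc n. cos (w k * x))\<^sup>2)
      = integral {-R..R} (\<lambda>x. (?g x)\<^sup>2 + (2 * (\<Sum>k=1..n. ?f x * cos (w k * x)) + (?f x)\<^sup>2))"
    by (intro integral_cong) (simp add: power2_sum sum_distrib_left algebra_simps)
  also have "\<dots> = integral {-R..R} (\<lambda>x. (?g x)\<^sup>2)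
      + (2 * (\<Sum>k=1..n. integral {-R..R} (\<lambda>x. ?f x * cos (w k * x))) + integral {-R..R} (\<lambda>x. (?f x)\<^sup>2))"
    by (subst integral_add integral_mult_right integral_sum;
        (intro integrable_continuous_real continuous_intros | simp)?)+
  also have "\<dots> \<le> (2 * R + 4 / c) * real n + (2 * (2 / c) + 2 * R)"
  proof (intro add_mono Suc.IH mult_left_mono)
    have "(\<Sum>k=1..n. integral {-R..R} (\<lambda>x. ?f x * cos (w k * x))) \<le> (\<Sum>k=1..n. 2 / (c * real (Suc n)))"
    proof (rule sum_mono)
      fix k assume "k \<in> {1..n}"
      then show "integral {-R..R} (\<lambda>x. ?f x * cos (w k * x)) \<le> 2 / (c * real (Suc n))"
        using integral_cos_times_cos[of "w (Suc n)" "w k" "c * real (Suc n)" R]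
          nonneg[of k] nonneg[of "Suc n"] sep[of k "Suc n"] assms(3,4) by auto
    qed
    also have "\<dots> \<le> 2 / c"
      using \<open>c > 0\<close> by (simp add: divide_simps)
    finally show "(\<Sum>k=1..n. integral {-R..R} (\<lambda>x. ?f x * cos (w k * x))) \<le> 2 / c" .
    have "integral {-R..R} (\<lambda>x. (?f x)\<^sup>2) \<le> integral {-R..R} (\<lambda>x. 1)"
      by (intro integral_le integrable_continuous_real continuous_intros) (simp add: abs_square_le_1)
    then show "integral {-R..R} (\<lambda>x. (?f x)\<^sup>2) \<le> 2 * R"
      using \<open>R \<ge> 0\<close> by simp
  qed auto
  also have "\<dots> = (2 * R + 4 / c) * real (Suc n)"
    by (simp add: algebra_simps add_divide_distrib)
  finally show ?case .
qed

text \<open>With \<open>m\<close> the integer square root of \<open>n\<close>, at most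
  \<open>2 * m\<close> terms lie between \<open>m\<^sup>2\<close> and \<open>n\<close>. They are
  bounded by 1, so after division by \<open>n \<ge> m\<^sup>2\<close> they contribute at most
  \<open>2 / m\<close>.\<close>

lemma mean_tendsto_zero_if_square_subsequence:
  fixes u :: "nat \<Rightarrow> real"
  assumes bound: "\<And>k. \<bar>u k\<bar> \<le> 1"
    and lim: "(\<lambda>n. (\<Sum>k=1..n\<^sup>2. u k) / real (n\<^sup>2)) \<longlonglongrightarrow> 0"
  shows "(\<lambda>n. (\<Sum>k=1..n. u k) / real n) \<longlonglongrightarrow> 0"
proof (rule Lim_null_comparison)
  let ?S = "\<lambda>n. \<Sum>k=1..n. u k"
  let ?r = floor_sqrt
  have r: "filterlim ?r at_top sequentially"
    unfolding filterlim_at_top by (auto simp: eventually_sequentially le_floor_sqrt_iff)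
  show "\<forall>\<^sub>F n in sequentially. norm (?S n / real n)
      \<le> \<bar>?S ((?r n)\<^sup>2) / real ((?r n)\<^sup>2)\<bar> + 2 / real (?r n)"
    using eventually_gt_at_top[of 0]
  proof eventually_elim
    case (elim n)
    define m where "m = ?r n"
    have m: "m > 0" "m\<^sup>2 \<le> n" "n < (Suc m)\<^sup>2"
      using elim Suc_floor_sqrt_power2_gt[of n] by (auto simp: m_def)
    have "\<bar>sum u {m\<^sup>2<..n}\<bar> \<le> (\<Sum>k\<in>{m\<^sup>2<..n}. 1)"
      by (rule sum_abs[THEN order_trans]) (intro sum_mono bound)
    also have "\<dots> = real (n - m\<^sup>2)" by simp
    also have "\<dots> \<le> real (2 * m)"
      using m by (intro of_nat_mono) (simp add: power2_eq_square)
    finally have tail: "\<bar>sum u {m\<^sup>2<..n}\<bar> \<le> 2 * real m" by simp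
    have "{1..n} = {1..m\<^sup>2} \<union> {m\<^sup>2<..n}" using m(2) by auto
    then have "?S n = ?S (m\<^sup>2) + sum u {m\<^sup>2<..n}"
      by (simp add: sum.union_disjoint ivl_disj_int)
    then have "\<bar>?S n\<bar> \<le> \<bar>?S (m\<^sup>2)\<bar> + 2 * real m"
      using tail by linarith
    then have "\<bar>?S n\<bar> / real n \<le> (\<bar>?S (m\<^sup>2)\<bar> + 2 * real m) / real (m\<^sup>2)"
      by (intro frac_le of_nat_mono m(2)) (use m(1) in auto)
    also have "\<dots> = \<bar>?S (m\<^sup>2) / real (m\<^sup>2)\<bar> + 2 / real m"
      using m(1) by (simp add: add_divide_distrib power2_eq_square)
    finally show ?case by (simp add: m_def)
  qed
  have "(\<lambda>m. \<bar>?S (m\<^sup>2) / real (m\<^sup>2)\<bar> + 2 / real m) \<longlonglongrightarrow> 0 + 0"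
    using lim by (intro tendsto_add tendsto_rabs_zero lim_const_over_n)
  from filterlim_compose[OF this r]
  show "(\<lambda>n. \<bar>?S ((?r n)\<^sup>2) / real ((?r n)\<^sup>2)\<bar> + 2 / real (?r n)) \<longlonglongrightarrow> 0"
    by simp
qed

text \<open>On \<open>{-R..R}\<close> the mean at index \<open>n\<^sup>2\<close> has square integral
  O(1/n^2), which is summable. Exchanging sum and integral, the series of squares converges almost
  everywhere, so its terms tend to 0. Countably many \<open>R\<close> exhaust the line.\<close>

lemma AE_mean_cos_tendsto_zero:
  fixes w :: "nat \<Rightarrow> real" and c :: real
  assumes nonneg: "\<And>k. 1 \<le> k \<Longrightarrow> 0 \<le> w k"
    and sep: "\<And>j k. 1 \<le> j \<Longrightarrow> j < k \<Longrightarrow> c * real k \<le> \<bar>w k - w j\<bar>"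
    and "c > 0"
  shows "AE x in lborel. (\<lambda>n. (\<Sum>k=1..n. cos (w k * x)) / real n) \<longlonglongrightarrow> 0"
proof -
  define g where "g n x = (\<Sum>k=1..n. cos (w k * x)) / real n" for n x
  have meas [measurable]: "g n \<in> borel_measurable borel" for n
    unfolding g_def by measurable
  have loc: "AE x in lborel. x \<in> {-real R..real R} \<longrightarrow> (\<lambda>n. g (n\<^sup>2) x) \<longlonglongrightarrow> 0" for R :: nat
  proof -
    let ?I = "{-real R..real R}"
    define C where "C = 2 * real R + 4 / c"
    have "C \<ge> 0" using \<open>c > 0\<close> by (simp add: C_def)
    have bound: "(\<integral>\<^sup>+x. ennreal ((g (n\<^sup>2) x)\<^sup>2 * indicator ?I x) \<partial>lborel) \<le> ennreal (C * inverse (real n ^ 2))" for n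
    proof (cases "n = 0")
      \<comment> \<open>Both sides are 0 here: the sum is empty and
        \<open>inverse 0 = 0\<close>.\<close>
      case True
      then show ?thesis by (simp add: g_def)
    next
      case False
      have cont: "continuous_on ?I (\<lambda>x. (g (n\<^sup>2) x)\<^sup>2)"
        using False unfolding g_def by (intro continuous_intros) auto
      have "(\<integral>\<^sup>+x. ennreal ((g (n\<^sup>2) x)\<^sup>2 * indicator ?I x) \<partial>lborel)
          = (\<integral>\<^sup>+x. ennreal ((g (n\<^sup>2) x)\<^sup>2) * indicator ?I x \<partial>lborel)"
        by (intro nn_integral_cong) (auto simp: indicator_def)
      also have "\<dots> = ennreal (integral ?I (\<lambda>x. (g (n\<^sup>2) x)\<^sup>2))"
        by (intro nn_integral_has_integral_lebesgue' integrable_integral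
              integrable_continuous_real cont) auto
      also have "integral ?I (\<lambda>x. (g (n\<^sup>2) x)\<^sup>2)
          = integral ?I (\<lambda>x. (\<Sum>k=1..n\<^sup>2. cos (w k * x))\<^sup>2) / (real (n\<^sup>2))\<^sup>2"
        by (simp add: g_def power_divide)
      also have "\<dots> \<le> (C * real (n\<^sup>2)) / (real (n\<^sup>2))\<^sup>2"
        unfolding C_def
        by (intro divide_right_mono integral_cos_sum_square nonneg sep \<open>c > 0\<close>) auto
      also have "\<dots> = C * inverse (real n ^ 2)"
        using False by (simp add: power2_eq_square field_simps)
      finally show ?thesis by (simp add: ennreal_leI)
    qed
    have "(\<integral>\<^sup>+x. (\<Sum>n. ennreal ((g (n\<^sup>2) x)\<^sup>2 * indicator ?I x)) \<partial>lborel)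
        = (\<Sum>n. \<integral>\<^sup>+x. ennreal ((g (n\<^sup>2) x)\<^sup>2 * indicator ?I x) \<partial>lborel)"
      by (rule nn_integral_suminf) measurable
    also have "\<dots> \<le> (\<Sum>n. ennreal (C * inverse (real n ^ 2)))"
      by (intro suminf_le bound summableI)
    also have "\<dots> < \<infinity>"
      using \<open>C \<ge> 0\<close> inverse_power_summable[of 2, where 'a = real]
      by (subst suminf_ennreal2) (auto intro!: summable_mult)
    finally have "AE x in lborel. (\<Sum>n. ennreal ((g (n\<^sup>2) x)\<^sup>2 * indicator ?I x)) \<noteq> \<infinity>"
      by (intro nn_integral_noteq_infinite) auto
    then show ?thesis
    proof eventually_elim
      case (elim x)
      then have "summable (\<lambda>n. (g (n\<^sup>2) x)\<^sup>2 * indicator ?I x)"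
        by (intro summable_suminf_not_top) auto
      then have *: "(\<lambda>n. (g (n\<^sup>2) x)\<^sup>2 * indicator ?I x) \<longlonglongrightarrow> 0"
        by (rule summable_LIMSEQ_zero)
      show ?case
      proof
        assume "x \<in> ?I"
        with * have "(\<lambda>n. (g (n\<^sup>2) x)\<^sup>2) \<longlonglongrightarrow> 0" by simp
        then show "(\<lambda>n. g (n\<^sup>2) x) \<longlonglongrightarrow> 0"
          by (simp add: power_tendsto_0_iff)
      qed
    qed
  qed
  then have "AE x in lborel. \<forall>R::nat. x \<in> {-real R..real R} \<longrightarrow> (\<lambda>n. g (n\<^sup>2) x) \<longlonglongrightarrow> 0"
    by (subst AE_all_countable) blast
  then show ?thesis
  proof eventually_elim
    case (elim x)
    obtain R :: nat where "\<bar>x\<bar> \<le> real R" using real_arch_simple by blast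
    with elim have "(\<lambda>n. g (n\<^sup>2) x) \<longlonglongrightarrow> 0" by (auto simp: abs_le_iff)
    then show ?case
      unfolding g_def by (intro mean_tendsto_zero_if_square_subsequence) auto
  qed
qed

section \<open>Separation of the frequencies and almost everywhere convergence\<close>

definition freq :: "nat \<Rightarrow> real" where
  "freq k = Gamma (real k) / real k"

lemma freq_eq_fact: "k \<ge> 1 \<Longrightarrow> freq k = fact (k - 1) / real k"
  by (simp add: freq_def Gamma_real_eq_fact)

lemma freq_Suc: "k \<ge> 1 \<Longrightarrow> freq (Suc k) = freq k * (real k)\<^sup>2 / real (Suc k)"
  by (cases k) (auto simp: freq_eq_fact power2_eq_square)

text \<open>The ratio of consecutive values is k^2/(k+1), which exceeds k - 1 because (k-1)(k+1) <
  k^2. The lower bound 3/2 is the value at 4; it propagates since the ratio is at least 1 from there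
  on.\<close>

lemma freq_growth:
  assumes "k \<ge> 4"
  shows "freq k \<ge> 3 / 2 \<and> (real k - 1) * freq k \<le> freq (Suc k)"
  using assms
proof (induction k rule: dec_induct)
  case base
  show ?case by (simp add: freq_eq_fact fact_numeral)
next
  case (step k)
  have *: "(real k - 1) * freq k \<le> freq (Suc k)" if "k \<ge> 4" "freq k \<ge> 3/2" for k
  proof -
    have "(real k - 1) * freq k * real (Suc k) \<le> freq k * (real k)\<^sup>2"
      using that by (simp add: power2_eq_square algebra_simps)
    then show ?thesis using that by (simp add: freq_Suc field_simps del: of_nat_Suc)
  qed
  have "1 * freq k \<le> (real k - 1) * freq k"
    using step by (intro mult_right_mono) auto
  with step have "freq (Suc k) \<ge> 3/2" by linarith
  with *[of "Suc k"] step show ?case by simp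
qed

text \<open>The constant is dictated by the closest early pair, j = 2 and k = 3, whose gap 1/6 just
  exceeds 3/20. For k at least 5 the jump from \<open>freq (k - 1)\<close> to \<open>freq k\<close>
  alone is large enough.\<close>

lemma freq_separated:
  assumes "1 \<le> j" "j < k"
  shows "1/20 * real k \<le> \<bar>freq k - freq j\<bar>"
proof -
  have small: "freq (Suc 0) = 1" "freq 2 = 1/2" "freq 3 = 2/3" "freq 4 = 3/2"
    by (simp_all add: freq_eq_fact fact_numeral)
  \<comment> \<open>The values 1, 1/2, 2/3, 3/2 are not monotone at the start, so the comparison
    with all earlier values begins at 4.\<close>
  have max: "\<forall>j\<in>{1..m}. freq j \<le> freq m" if "m \<ge> 4" for m
    using that
  proof (induction m rule: dec_induct)
    case base
    have "{1..4} = {1,2,3,4::nat}" by auto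
    then show ?case by (simp add: small)
  next
    case (step m)
    have "1 * freq m \<le> (real m - 1) * freq m"
      using step(1) freq_growth[of m] by (intro mult_right_mono) auto
    then have "freq m \<le> freq (Suc m)"
      using step(1) freq_growth[of m] by linarith
    with step show ?case by (auto simp: le_Suc_eq intro: order_trans)
  qed
  consider "k \<in> {2,3,4}" | "k \<ge> 5" using assms by force
  then show ?thesis
  proof cases
    case 1
    then have "j = 1 \<or> j = 2 \<or> j = 3" using assms by auto
    with 1 assms show ?thesis by (auto simp: small)
  next
    case 2
    then obtain m where m: "k = Suc m" "m \<ge> 4" by (cases k) auto
    have "freq j \<le> freq m" using max[OF m(2)] assms m by auto
    have *: "freq m + 3/2 * (t - 2) \<le> freq k" "1/20 * real k \<le> 3/2 * (t - 2)"
      if "t = real m" for t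
    proof -
      have "(t - 2) * (3/2) \<le> (t - 2) * freq m"
        using that m(2) freq_growth[of m] by (intro mult_left_mono) auto
      then show "freq m + 3/2 * (t - 2) \<le> freq k"
        using that freq_growth[OF m(2)] m(1) by (simp add: algebra_simps)
      show "1/20 * real k \<le> 3/2 * (t - 2)" using that m by (simp add: field_simps)
    qed
    have "1/20 * real k \<le> freq k - freq j"
      using \<open>freq j \<le> freq m\<close> *[OF refl] by linarith
    then show ?thesis by linarith
  qed
qed

lemma s_eq_cos_sum: "s n x = real n / 2 - (\<Sum>k=1..n. cos (2 * freq k * x)) / 2"
proof -
  have "s n x = (\<Sum>k=1..n. 1 / 2 - cos (2 * freq k * x) / 2)"
    unfolding s_def
  proof (rule sum.cong)
    fix k
    show "(sin (x * Gamma (real k) / real k))\<^sup>2 = 1 / 2 - cos (2 * freq k * x) / 2"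
      using cos_double_sin[of "freq k * x"] by (simp add: freq_def mult_ac diff_divide_distrib)
  qed simp
  then show ?thesis by (simp add: sum_subtractf sum_divide_distrib)
qed

lemma AE_s_over_n:
  "AE x in lebesgue. (\<lambda>n. s n x / real n) \<longlonglongrightarrow> 1 / 2"
proof (rule AE_completion)
  have "AE x in lborel. (\<lambda>n. (\<Sum>k=1..n. cos (2 * freq k * x)) / real n) \<longlonglongrightarrow> 0"
  \<comment> \<open>The half-angle formula doubles the frequencies, and with them the separation
    constant 1/20.\<close>
  proof (rule AE_mean_cos_tendsto_zero[where c = "1/10"])
    show "1/10 * real k \<le> \<bar>2 * freq k - 2 * freq j\<bar>" if "1 \<le> j" "j < k" for j k
      using freq_separated[OF that] by linarith
  qed (auto simp: freq_def intro!: divide_nonneg_nonneg Gamma_real_nonneg)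
  then show "AE x in lborel. (\<lambda>n. s n x / real n) \<longlonglongrightarrow> 1 / 2"
  proof eventually_elim
    case (elim x)
    have "(\<lambda>n. 1 / 2 - ((\<Sum>k=1..n. cos (2 * freq k * x)) / real n) / 2) \<longlonglongrightarrow> 1 / 2 - 0 / 2"
      by (intro tendsto_intros elim) auto
    moreover have "\<forall>\<^sub>F n in sequentially.
        1 / 2 - ((\<Sum>k=1..n. cos (2 * freq k * x)) / real n) / 2 = s n x / real n"
      using eventually_gt_at_top[of 0] by eventually_elim (simp add: s_eq_cos_sum field_simps)
    ultimately show ?case
      by (simp add: filterlim_cong[OF refl refl] tendsto_cong)
  qed
qed

section \<open>A lower bound for the number of primes\<close>

lemma le_prime_count_four_power: "m \<le> prime_count (4 ^ m)"
proof -
  let ?P = "{p::nat. prime p \<and> p \<le> 4 ^ m}"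
  have fin: "finite ?P" by (rule finite_subset[of _ "{..4 ^ m}"]) auto
  \<comment> \<open>Each k up to 4^m is its squarefree part, determined by a set of primes up to
    4^m, times the square of some d up to 2^m. Counting the pairs gives 4^m \<le> 2^Pi(4^m) *
    2^m.\<close>
  have "{1..4 ^ m} \<subseteq> (\<lambda>(A, d). \<Prod>A * d\<^sup>2) ` (Pow ?P \<times> {1..2 ^ m})"
  proof
    fix k :: nat assume k: "k \<in> {1..4 ^ m}"
    let ?A = "prime_factors (squarefree_part k)"
    have dvd: "squarefree_part k dvd k"
      by (rule dvdI[OF squarefree_decompose])
    have "?A \<subseteq> ?P"
    proof
      fix p assume p: "p \<in> ?A"
      then have "p dvd k" using dvd by (meson dvd_trans in_prime_factors_imp_dvd)
      then show "p \<in> ?P" using p k by (auto dest: dvd_imp_le)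
    qed
    moreover have "\<Prod>?A = squarefree_part k"
    proof -
      have "\<Prod>?A = (\<Prod>p\<in>?A. p ^ multiplicity p (squarefree_part k))"
        using squarefree_factorial_semiring'[THEN iffD1, OF squarefree_part_nonzero
            squarefree_squarefree_part, of k]
        by (intro prod.cong) auto
      also have "\<dots> = normalize (squarefree_part k)"
        by (intro prod_prime_factors) simp
      finally show ?thesis by simp
    qed
    moreover have "square_part k \<in> {1..2 ^ m}"
    proof -
      have "(square_part k)\<^sup>2 \<le> k" using k by (intro dvd_imp_le) auto
      also have "\<dots> \<le> (2 ^ m)\<^sup>2" using k by (simp add: power2_eq_square flip: power_mult_distrib)
      finally have "square_part k \<le> 2 ^ m" by (simp add: power2_nat_le_eq_le)
      moreover have "square_part k > 0" using k by (intro Nat.gr0I) simp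
      ultimately show ?thesis by simp
    qed
    ultimately show "k \<in> (\<lambda>(A, d). \<Prod>A * d\<^sup>2) ` (Pow ?P \<times> {1..2 ^ m})"
      using squarefree_decompose[of k, symmetric]
      by (intro image_eqI[of _ _ "(?A, square_part k)"]) auto
  qed
  then have "card {1..4 ^ m :: nat} \<le> card (Pow ?P \<times> {1..2 ^ m :: nat})"
    using fin by (intro surj_card_le) auto
  then have "2 ^ m * 2 ^ m \<le> 2 ^ prime_count (4 ^ m) * (2 ^ m :: nat)"
    using fin by (simp add: card_cartesian_product card_Pow prime_count_def flip: power_mult_distrib)
  then show ?thesis by simp
qed

section \<open>Averages over consecutive multiples of pi / L!\<close>

text \<open>Write k = u v with 1 < u \<le> v. If u < v, both are distinct factors of v!, and v \<le>
  k/2. If u = v, then u and 2u are distinct factors of (2u)!, and 2u \<le> k/2 because k \<ge> 16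
  forces u \<ge> 4. So k divides (k div 2)!, and the bound on \<open>L\<close> leaves room for L!
  within (k - 1)!.\<close>

lemma mult_fact_dvd_fact:
  fixes k L :: nat
  assumes "\<not> prime k" "16 \<le> k" "2 * L + 2 \<le> k"
  shows "k * fact L dvd (fact (k - 1) :: nat)"
proof -
  obtain u v where uv: "k = u * v" "1 < u" "u \<le> v"
  proof -
    obtain u where u: "u dvd k" "u \<noteq> 1" "u \<noteq> k"
      using assms by (auto simp: prime_nat_iff)
    then obtain v where v: "k = u * v" by auto
    have "u > 1" "v > 1" using u v assms by (cases u; cases v; auto)+
    with v that[of u v] that[of v u] show thesis by (cases "u \<le> v") (auto simp: mult.commute)
  qed
  have "k dvd fact (k div 2)"
  proof (cases "u = v")
    case False
    have "2 * v \<le> u * v" using uv by (intro mult_right_mono) auto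
    then have "v \<le> k div 2" using uv(1) by (simp add: less_eq_div_iff_mult_less_eq mult.commute)
    moreover have "u dvd fact (v - 1)" using uv False by (intro dvd_fact) auto
    moreover have "(fact v :: nat) = v * fact (v - 1)" using uv(2,3) by (simp add: fact_reduce)
    ultimately have "u * v dvd fact v" by (simp add: mult.commute[of u])
    then show ?thesis using \<open>v \<le> k div 2\<close> uv(1) by (metis dvd_trans fact_dvd)
  next
    case True
    have "u \<ge> 4"
    proof (rule ccontr)
      assume "\<not> u \<ge> 4"
      then have "u * u \<le> 3 * 3" by (intro mult_mono) auto
      then show False using assms uv True by simp
    qed
    then have "2 * u \<le> k div 2" using uv True by (auto simp: less_eq_div_iff_mult_less_eq)
    moreover have "u dvd fact (2 * u - 1)" using uv by (intro dvd_fact) auto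
    moreover have "(fact (2 * u) :: nat) = 2 * u * fact (2 * u - 1)" using uv(2,3) by (simp add: fact_reduce)
    ultimately have "u * u dvd fact (2 * u)" by simp
    then show ?thesis using \<open>2 * u \<le> k div 2\<close> uv(1) True by (metis dvd_trans fact_dvd)
  qed
  then have "k * fact L dvd fact (k div 2) * fact L" by (rule mult_dvd_mono) simp
  also have "\<dots> dvd fact (k div 2 + L)" by (rule fact_fact_dvd_fact)
  also have "\<dots> dvd fact (k - 1)" using assms by (intro fact_dvd) auto
  finally show ?thesis .
qed

text \<open>Reduction modulo p and reflection replace N by its distance q to the nearest multiple of
  p, where 1 \<le> q \<le> p/2; on this range the sine increases, so q = 1 is the worst case. There
  the mean value theorem applies, with cosine at least 1/2 up to pi/3, which is where p \<ge> 3
  enters.\<close>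

lemma abs_sin_pi_frac_ge:
  fixes p N :: nat
  assumes "3 \<le> p" "\<not> p dvd N"
  shows "1 / real p \<le> \<bar>sin (pi * real N / real p)\<bar>"
proof -
  define r where "r = N mod p"
  have r: "1 \<le> r" "r < p" using assms by (auto simp: r_def Suc_le_eq mod_greater_zero_iff_not_dvd)
  have "real N = real r + real (N div p) * real p"
    by (simp add: r_def flip: of_nat_mult of_nat_add)
  then have "pi * real N / real p = pi * real r / real p + real (N div p) * pi"
    using assms by (simp add: field_simps)
  then have eq: "\<bar>sin (pi * real N / real p)\<bar> = \<bar>sin (pi * real r / real p)\<bar>"
    by (simp add: sin_add abs_mult)
  define q where "q = min r (p - r)"
  have q: "1 \<le> q" "2 * q \<le> p" using r by (auto simp: q_def)
  have "sin (pi * real r / real p) = sin (pi * real q / real p)"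
  proof (cases "q = r")
    case False
    then have "real q = real p - real r"
      using r by (simp add: q_def min_def of_nat_diff split: if_splits)
    then have "pi * real r / real p = pi - pi * real q / real p"
      using r by (simp add: right_diff_distrib diff_divide_distrib)
    then show ?thesis by simp
  qed simp
  moreover have "sin (pi / real p) \<le> sin (pi * real q / real p)"
  proof (rule sin_monotone_2pi_le)
    have "0 \<le> pi / real p" by simp
    then show "- (pi / 2) \<le> pi / real p" using pi_ge_zero by linarith
    show "pi / real p \<le> pi * real q / real p"
      using q by (intro divide_right_mono) (auto simp: mult_le_cancel_left1)
    have "pi * (2 * real q) \<le> pi * real p" using q by (intro mult_left_mono) auto
    then show "pi * real q / real p \<le> pi / 2" using assms by (simp add: field_simps)
  qed
  moreover have "1 / real p \<le> sin (pi / real p)"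
  proof -
    have pos: "0 < pi / real p" "pi / real p \<le> pi / 3" using assms by (auto simp: field_simps)
    obtain z where z: "0 < z" "z < pi / real p" "sin (pi / real p) - sin 0 = (pi / real p - 0) * cos z"
      using MVT2[OF pos(1), of sin cos] by (auto intro: DERIV_sin)
    have "z \<le> pi / 3" using z(2) pos(2) by linarith
    then have "cos (pi / 3) \<le> cos z" using z(1) by (intro cos_monotone_0_pi_le) auto
    then have "pi / real p * (1 / 2) \<le> pi / real p * cos z"
      using pos by (intro mult_left_mono) (auto simp: cos_60)
    moreover have "1 / real p \<le> pi / real p * (1 / 2)"
      using pi_ge_two assms by (simp add: field_simps)
    ultimately show ?thesis using z by simp
  qed
  ultimately show ?thesis unfolding eq by linarith
qed

text \<open>Multiplication by \<open>2 * sin \<theta>\<close> makes the sum telescope into a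
  difference of two sines. The product form covers \<open>sin \<theta> = 0\<close> as well.\<close>

lemma abs_sum_cos_arith_progression:
  fixes \<alpha> \<theta> :: real
  shows "\<bar>sin \<theta>\<bar> * \<bar>\<Sum>i<M. cos (\<alpha> + 2 * real i * \<theta>)\<bar> \<le> 1"
proof -
  have eq: "2 * sin \<theta> * (\<Sum>i<M. cos (\<alpha> + 2 * real i * \<theta>)) = sin (\<alpha> + (2 * real M - 1) * \<theta>) - sin (\<alpha> - \<theta>)"
  proof (induction M)
    case (Suc M)
    define A B where "A = \<alpha> + (2 * real (Suc M) - 1) * \<theta>" and "B = \<alpha> + (2 * real M - 1) * \<theta>"
    have "(A - B) / 2 = \<theta>" "(A + B) / 2 = \<alpha> + 2 * real M * \<theta>"
      by (simp_all add: A_def B_def algebra_simps add_divide_distrib diff_divide_distrib)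
    then have "2 * sin \<theta> * cos (\<alpha> + 2 * real M * \<theta>) = sin A - sin B"
      by (simp only: sin_diff_sin)
    with Suc show ?case by (simp add: distrib_left A_def B_def)
  qed simp
  have "2 * (\<bar>sin \<theta>\<bar> * \<bar>\<Sum>i<M. cos (\<alpha> + 2 * real i * \<theta>)\<bar>) = \<bar>2 * sin \<theta> * (\<Sum>i<M. cos (\<alpha> + 2 * real i * \<theta>))\<bar>"
    by (simp add: abs_mult)
  also have "\<dots> = \<bar>sin (\<alpha> + (2 * real M - 1) * \<theta>) - sin (\<alpha> - \<theta>)\<bar>"
    unfolding eq ..
  also have "\<dots> \<le> 1 + 1"
    by (intro order_trans[OF abs_triangle_ineq4] add_mono) auto
  finally show ?thesis by simp
qed

text \<open>Since k L! divides (k - 1)!, the argument is an integer multiple of pi.\<close>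

lemma sin_term_composite_eq_zero:
  fixes k L :: nat and t :: int
  assumes "\<not> prime k" "2 * L + 16 \<le> k"
  shows "sin (pi * of_int t / fact L * Gamma (real k) / real k) = 0"
proof -
  obtain c :: nat where c: "fact (k - 1) = k * fact L * c"
    using mult_fact_dvd_fact[of k L] assms by (auto elim: dvdE)
  have "Gamma (real k) = real (k * fact L * c)"
    using assms by (simp only: Gamma_real_eq_fact of_nat_fact flip: c)
  then have "pi * of_int t / fact L * Gamma (real k) / real k = of_int (t * int c) * pi"
    using assms by (simp add: field_simps)
  then show ?thesis
    by (simp only: sin_zero_iff_int2) blast
qed

text \<open>With N = (k - 1)! / L!, the argument advances by pi N / k at each step. A prime k does
  not divide (k - 1)!, hence not N, so the sine of this step is at least 1/k in absolute value and
  the cosine sum is at most k. The half-angle formula halves it.\<close>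

lemma averaged_sin_square_term_prime:
  fixes k L M :: nat and a :: int
  assumes "prime k" "2 * L + 16 \<le> k"
  shows "\<bar>(\<Sum>i<M. (sin (pi * of_int (a + int i) / fact L * Gamma (real k) / real k))\<^sup>2) - real M / 2\<bar> \<le> real k / 2"
proof -
  have "(fact L :: nat) dvd fact (k - 1)" using assms by (intro fact_dvd) auto
  then obtain N :: nat where N: "fact (k - 1) = fact L * N" by (elim dvdE)
  have "\<not> k dvd N"
  proof
    assume "k dvd N"
    then have "k dvd fact (k - 1)" unfolding N by (rule dvd_mult)
    with assms show False by (simp add: prime_dvd_fact_iff)
  qed
  define \<theta> where "\<theta> = pi * real N / real k"
  have "Gamma (real k) = real (fact (k - 1))"
    using assms by (simp add: Gamma_real_eq_fact)
  then have G: "Gamma (real k) = fact L * real N"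
    unfolding N by simp
  have "(sin (pi * of_int (a + int i) / fact L * Gamma (real k) / real k))\<^sup>2
      = 1 / 2 - cos (2 * of_int a * \<theta> + 2 * real i * \<theta>) / 2" for i
  proof -
    have eq: "pi * of_int (a + int i) / fact L * Gamma (real k) / real k = of_int a * \<theta> + real i * \<theta>"
      using assms by (simp add: G \<theta>_def field_simps)
    show ?thesis
      unfolding eq using cos_double_sin[of "of_int a * \<theta> + real i * \<theta>"]
      by (simp add: algebra_simps diff_divide_distrib)
  qed
  then have "(\<Sum>i<M. (sin (pi * of_int (a + int i) / fact L * Gamma (real k) / real k))\<^sup>2) - real M / 2
      = - (\<Sum>i<M. cos (2 * of_int a * \<theta> + 2 * real i * \<theta>)) / 2"
    by (simp add: sum_subtractf sum_divide_distrib)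
  moreover have "\<bar>\<Sum>i<M. cos (2 * of_int a * \<theta> + 2 * real i * \<theta>)\<bar> \<le> real k" (is "\<bar>?C\<bar> \<le> _")
  proof -
    have "1 / real k * \<bar>?C\<bar> \<le> \<bar>sin \<theta>\<bar> * \<bar>?C\<bar>"
      unfolding \<theta>_def using assms \<open>\<not> k dvd N\<close> by (intro mult_right_mono abs_sin_pi_frac_ge) auto
    also have "\<dots> \<le> 1" by (rule abs_sum_cos_arith_progression)
    finally show ?thesis using assms by (simp add: field_simps)
  qed
  ultimately show ?thesis by simp
qed

text \<open>After exchanging the sums, each k below 2 L + 16 costs at most M, larger composite k
  contribute nothing, and each larger prime contributes M/2 up to an error k/2 \<le> n/2.\<close>

lemma averaged_s:
  fixes L M n :: nat and a :: int
  shows "\<bar>(\<Sum>i<M. s n (pi * of_int (a + int i) / fact L)) - real M * real (prime_count n) / 2\<bar>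
    \<le> real M * real (2 * L + 16) + real (prime_count n) * (real n / 2)"
proof -
  define T where "T k = (\<Sum>i<M. (sin (pi * of_int (a + int i) / fact L * Gamma (real k) / real k))\<^sup>2)" for k :: nat
  have count: "(\<Sum>k=1..n. if prime k then c else 0) = real (prime_count n) * c" for c :: real
  proof -
    have "{k \<in> {1..n}. prime k} = {p. prime p \<and> p \<le> n}" by (auto dest: prime_ge_1_nat)
    then show ?thesis by (simp add: prime_count_def flip: sum.inter_filter)
  qed
  have small: "(\<Sum>k=1..n. if k < 2 * L + 16 then real M else 0) \<le> real M * real (2 * L + 16)"
  proof -
    have "card {k \<in> {1..n}. k < 2 * L + 16} \<le> card {..<2 * L + 16}"
      by (intro card_mono) auto
    then have "real (card {k \<in> {1..n}. k < 2 * L + 16}) * real M \<le> real (2 * L + 16) * real M"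
      by (intro mult_right_mono of_nat_mono) auto
    then show ?thesis by (simp add: mult.commute flip: sum.inter_filter)
  qed
  have err: "\<bar>T k - (if prime k then real M / 2 else 0)\<bar>
      \<le> (if k < 2 * L + 16 then real M else 0) + (if prime k then real n / 2 else 0)"
    if "k \<in> {1..n}" for k
  proof (cases "k < 2 * L + 16")
    case True
    have "T k \<le> (\<Sum>i<M. 1)" unfolding T_def by (intro sum_mono) (simp add: abs_square_le_1)
    moreover have "0 \<le> T k" unfolding T_def by (intro sum_nonneg) auto
    ultimately show ?thesis using True by (auto simp: abs_le_iff)
  next
    case False
    then show ?thesis
      using averaged_sin_square_term_prime[where k = k and L = L and M = M and a = a] sin_term_composite_eq_zero[where k = k and L = L] that
      by (auto simp: T_def simp del: of_int_add)
  qed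
  have "(\<Sum>i<M. s n (pi * of_int (a + int i) / fact L)) = (\<Sum>k=1..n. T k)"
    unfolding s_def T_def by (rule sum.swap)
  then have "\<bar>(\<Sum>i<M. s n (pi * of_int (a + int i) / fact L)) - real M * real (prime_count n) / 2\<bar>
      = \<bar>\<Sum>k=1..n. T k - (if prime k then real M / 2 else 0)\<bar>"
    unfolding sum_subtractf count by (simp add: mult.commute)
  also have "\<dots> \<le> (\<Sum>k=1..n. (if k < 2 * L + 16 then real M else 0) + (if prime k then real n / 2 else 0))"
    by (rule sum_abs[THEN order_trans]) (intro sum_mono err)
  also have "\<dots> \<le> real M * real (2 * L + 16) + real (prime_count n) * (real n / 2)"
    unfolding sum.distrib count using small by simp
  finally show ?thesis .
qed

section \<open>Density of the near-1/2 sets and the Baire argument\<close>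

lemma exists_s_ratio_near_half:
  fixes u v \<epsilon> :: real and N :: nat
  assumes "u < v" "\<epsilon> > 0"
  shows "\<exists>n\<ge>N. \<exists>x\<in>{u<..<v}. \<bar>s n x / real (prime_count n) - 1 / 2\<bar> < \<epsilon>"
proof -
  \<comment> \<open>This makes 2 L + 16 \<le> 18 L at most \<open>\<epsilon> / 2\<close> times K L,
    the lower bound for the prime count.\<close>
  obtain K :: nat where K: "36 / \<epsilon> < real K" using reals_Archimedean2 by blast
  then have "K > 0" using \<open>\<epsilon> > 0\<close> by (cases K) (auto simp: field_simps)
  \<comment> \<open>About \<open>c * fact L\<close> grid steps of length pi / L! cover half of the
    interval; the other half keeps the last point strictly below \<open>v\<close>.\<close>
  define c where "c = (v - u) / (2 * pi)"
  have "c > 0" using \<open>u < v\<close> by (simp add: c_def)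
  have "(\<lambda>L. inverse (fact L) * (4 ^ K) ^ L :: real) \<longlonglongrightarrow> 0"
    by (rule summable_LIMSEQ_zero[OF summable_exp])
  \<comment> \<open>The factor \<open>1 / (1 + \<epsilon>)\<close> absorbs the rounding in
    \<open>M\<close>: it yields n + \<epsilon> < \<epsilon> c L!, hence n < \<epsilon> (c L! - 1)
    \<le> \<epsilon> M.\<close>
  moreover have "0 < \<epsilon> * c / (1 + \<epsilon>)" using \<open>c > 0\<close> \<open>\<epsilon> > 0\<close> by simp
  ultimately have "\<forall>\<^sub>F L in sequentially. inverse (fact L) * (4 ^ K) ^ L < \<epsilon> * c / (1 + \<epsilon>)"
    by (rule order_tendstoD(2))
  then have "\<forall>\<^sub>F L in sequentially. inverse (fact L) * (4 ^ K) ^ L < \<epsilon> * c / (1 + \<epsilon>) \<and> max 1 N \<le> L"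
    using eventually_ge_at_top by (rule eventually_conj)
  then obtain L where L: "inverse (fact L) * (4 ^ K) ^ L < \<epsilon> * c / (1 + \<epsilon>)" "1 \<le> L" "N \<le> L"
    unfolding eventually_sequentially by auto
  define n :: nat where "n = 4 ^ (K * L)"
  define P where "P = real (prime_count n)"
  define M where "M = nat \<lfloor>c * fact L\<rfloor>"
  define a where "a = \<lfloor>u * fact L / pi\<rfloor> + 1"
  define y where "y i = pi * of_int (a + int i) / fact L" for i
  have "N \<le> n"
  proof -
    have "L \<le> K * L" using \<open>K > 0\<close> by simp
    also have "\<dots> < n" unfolding n_def by (rule less_exp[THEN less_le_trans]) (simp add: power_mono)
    finally show ?thesis using L(3) by simp
  qed
  have P: "real K * real L \<le> P"
    using le_prime_count_four_power[of "K * L"] unfolding P_def n_def by (metis of_nat_le_iff of_nat_mult)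
  moreover have "0 < real K * real L" using \<open>K > 0\<close> L by simp
  ultimately have "P > 0" by linarith
  have n_less: "real n < \<epsilon> * real M"
  proof -
    have "1 \<le> real n" by (simp add: n_def)
    have "real n + \<epsilon> \<le> (1 + \<epsilon>) * real n"
      using \<open>1 \<le> real n\<close> \<open>\<epsilon> > 0\<close> by (simp add: algebra_simps)
    also have "\<dots> < \<epsilon> * (c * fact L)"
      using L(1) \<open>\<epsilon> > 0\<close> by (simp add: n_def power_mult field_simps)
    finally have "real n < \<epsilon> * (c * fact L - 1)" by (simp add: algebra_simps)
    also have "\<dots> \<le> \<epsilon> * real M"
      unfolding M_def using \<open>\<epsilon> > 0\<close> by (intro mult_left_mono) linarith+
    finally show ?thesis .
  qed
  then have "M > 0" by (cases M) auto
  have y: "y i \<in> {u<..<v}" if "i < M" for i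
  proof -
    have "u * fact L / pi < of_int a" "of_int a \<le> u * fact L / pi + 1"
      unfolding a_def by linarith+
    moreover have "real i + 1 \<le> c * fact L"
      using that \<open>c > 0\<close> unfolding M_def by linarith
    ultimately have "u * fact L / pi < of_int (a + int i)" "of_int (a + int i) \<le> u * fact L / pi + c * fact L"
      by auto
    then have "u < y i" "y i \<le> u + c * pi"
      by (simp_all add: y_def field_simps)
    moreover have "u + c * pi < v" using \<open>u < v\<close> by (simp add: c_def field_simps)
    ultimately show ?thesis by auto
  qed
  \<comment> \<open>Small indices and the prime error terms each account for at most half of the
    allowed deviation.\<close>
  have avg: "\<bar>(\<Sum>i<M. s n (y i)) - real M * P / 2\<bar> < real M * (P * \<epsilon>)"
  proof -
    have "\<bar>(\<Sum>i<M. s n (y i)) - real M * P / 2\<bar> \<le> real M * real (2 * L + 16) + P * (real n / 2)"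
      unfolding y_def P_def by (rule averaged_s)
    moreover have "real (2 * L + 16) \<le> P * \<epsilon> / 2"
    proof -
      have "real (2 * L + 16) \<le> 18 * real L" using L by simp
      also have "\<dots> \<le> (real K * \<epsilon> / 2) * real L"
        using K \<open>\<epsilon> > 0\<close> by (intro mult_right_mono) (auto simp: field_simps)
      also have "\<dots> \<le> P * \<epsilon> / 2" using P \<open>\<epsilon> > 0\<close> by (simp add: field_simps)
      finally show ?thesis .
    qed
    then have "real M * real (2 * L + 16) \<le> real M * (P * \<epsilon> / 2)" by (rule mult_left_mono) simp
    moreover have "P * (real n / 2) < P * (\<epsilon> * real M / 2)"
      using n_less \<open>P > 0\<close> by (intro mult_strict_left_mono) auto
    moreover have "real M * (P * \<epsilon> / 2) + P * (\<epsilon> * real M / 2) = real M * (P * \<epsilon>)" by simp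
    ultimately show ?thesis by linarith
  qed
  define f where "f x = s n x / P" for x
  have "\<exists>i<M. f (y i) < 1 / 2 + \<epsilon>"
  proof (rule ccontr)
    assume "\<not> ?thesis"
    then have "1 / 2 + \<epsilon> \<le> f (y i)" if "i < M" for i
      using that by (meson not_less)
    then have "(\<Sum>i<M. P / 2 + P * \<epsilon>) \<le> (\<Sum>i<M. s n (y i))"
      using \<open>P > 0\<close> by (intro sum_mono) (simp add: f_def field_simps)
    with avg show False by (simp add: algebra_simps)
  qed
  then obtain i where i: "i < M" "f (y i) < 1 / 2 + \<epsilon>" by blast
  have "\<exists>i<M. 1 / 2 - \<epsilon> < f (y i)"
  proof (rule ccontr)
    assume "\<not> ?thesis"
    then have "f (y i) \<le> 1 / 2 - \<epsilon>" if "i < M" for i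
      using that by (meson not_less)
    then have "(\<Sum>i<M. s n (y i)) \<le> (\<Sum>i<M. P / 2 - P * \<epsilon>)"
      using \<open>P > 0\<close> by (intro sum_mono) (simp add: f_def field_simps)
    with avg show False by (simp add: algebra_simps)
  qed
  then obtain j where j: "j < M" "1 / 2 - \<epsilon> < f (y j)" by blast
  have "connected (f ` {u<..<v})"
    unfolding f_def s_def using \<open>P > 0\<close>
    by (intro connected_continuous_image continuous_intros) auto
  then have half: "1 / 2 \<in> f ` {u<..<v}" if "f (y i) \<le> 1 / 2" "1 / 2 \<le> f (y j)"
    using connectedD_interval[OF _ imageI[OF y[OF i(1)]] imageI[OF y[OF j(1)]] that] by blast
  \<comment> \<open>Either one of the two points already lies within \<open>\<epsilon>\<close> of
    1/2, or the values there straddle 1/2 and continuity supplies a point with value exactly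
    1/2.\<close>
  have "\<exists>x\<in>{u<..<v}. \<bar>f x - 1 / 2\<bar> < \<epsilon>"
  proof (cases "f (y i) \<le> 1 / 2 \<and> 1 / 2 \<le> f (y j)")
    case True
    then obtain x where "x \<in> {u<..<v}" "f x = 1 / 2" using half by (metis imageE)
    then show ?thesis using \<open>\<epsilon> > 0\<close> by (intro bexI[of _ x]) auto
  next
    case False
    then have "\<bar>f (y i) - 1 / 2\<bar> < \<epsilon> \<or> \<bar>f (y j) - 1 / 2\<bar> < \<epsilon>"
      using i j by linarith
    then show ?thesis using y i j by blast
  qed
  then show ?thesis using \<open>N \<le> n\<close> unfolding f_def P_def by blast
qed

text \<open>The set \<open>U N\<close> asks for closeness 1/(N+1) at some index n \<ge> N. It is
  open by continuity in x and dense by the interval statement, so Baire's theorem applies to the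
  intersection.\<close>

lemma exists_gdelta_dense_half_limit_point:
  "\<exists>G :: real set. gdelta_in euclidean G \<and> closure G = UNIV \<and>
    (\<forall>x\<in>G. liminf (\<lambda>n. ereal \<bar>s n x / real (prime_count n) - 1 / 2\<bar>) = 0)"
proof -
  define f where "f n x = \<bar>s n x / real (prime_count n) - 1 / 2\<bar>" for n x
  define U where "U N = (\<Union>n\<in>{N..}. {x. f n x < 1 / real (Suc N)})" for N
  have op: "open (U N)" for N
    unfolding U_def f_def s_def divide_inverse
    \<comment> \<open>\<open>prime_count n\<close> is 0 for n < 2. As multiplication by a constant
      inverse, the division is continuous without a nonzero condition.\<close>
    by (intro open_UN ballI open_Collect_less continuous_intros)
  have dense: "closure (U N) = UNIV" for N
  proof -
    have "U N \<inter> {u<..<v} \<noteq> {}" if "u < v" for u v :: real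
      using exists_s_ratio_near_half[OF that, of "1 / real (Suc N)" N]
      by (auto simp: U_def f_def)
    then have "U N \<inter> V \<noteq> {}" if "open V" "V \<noteq> {}" for V
    proof -
      obtain x where "x \<in> V" using \<open>V \<noteq> {}\<close> by blast
      with \<open>open V\<close> obtain e where "e > 0" "ball x e \<subseteq> V" by (auto simp: open_contains_ball)
      then have "{x - e<..<x + e} \<subseteq> V" by (simp add: ball_eq_greaterThanLessThan)
      with \<open>\<And>u v. u < v \<Longrightarrow> U N \<inter> {u<..<v} \<noteq> {}\<close>[of "x - e" "x + e"] \<open>e > 0\<close>
      show ?thesis by auto
    qed
    then show ?thesis using closure_iff_nhds_not_empty[of _ "U N"] by blast
  qed
  define G where "G = (\<Inter>N. U N)"
  have "gdelta_in euclidean G"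
    unfolding G_def by (intro gdelta_in_Inter) (auto intro!: open_imp_gdelta_in simp: op)
  moreover have "UNIV \<subseteq> closure G"
    unfolding G_def by (intro Baire) (auto simp: op dense)
  moreover have "liminf (\<lambda>n. ereal (f n x)) = 0" if "x \<in> G" for x
  proof (rule antisym)
    show "0 \<le> liminf (\<lambda>n. ereal (f n x))"
      by (intro Liminf_bounded always_eventually) (simp add: f_def)
    show "liminf (\<lambda>n. ereal (f n x)) \<le> 0"
    proof (rule ccontr)
      assume "\<not> ?thesis"
      then obtain e where e: "0 < ereal e" "ereal e < liminf (\<lambda>n. ereal (f n x))"
        using ereal_dense2[of 0] by (auto simp: not_le)
      then have "\<forall>\<^sub>F n in sequentially. e < f n x"
        using less_LiminfD[OF e(2)] by simp
      then obtain N0 where N0: "\<And>n. n \<ge> N0 \<Longrightarrow> e < f n x" by (auto simp: eventually_sequentially)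
      obtain N1 where N1: "1 / real (Suc N1) < e"
        using reals_Archimedean e(1) by (auto simp: inverse_eq_divide)
      \<comment> \<open>The maximum makes the index n late enough for the lower bound
        \<open>e\<close> and the tolerance smaller than \<open>e\<close>.\<close>
      from that have "x \<in> U (max N0 N1)" by (simp add: G_def)
      then obtain n where n: "n \<ge> max N0 N1" "f n x < 1 / real (Suc (max N0 N1))" by (auto simp: U_def)
      have "1 / real (Suc (max N0 N1)) \<le> 1 / real (Suc N1)" by (simp add: frac_le)
      with n N0[of n] N1 show False by simp
    qed
  qed
  ultimately show ?thesis unfolding f_def by auto
qed

text \<open>A liminf is the limit along some subsequence; this passes from the liminf form of a
  limit point to the subsequence form.\<close>

lemma strict_mono_subseq_tendsto_if_liminf_zero:
  fixes h :: "nat \<Rightarrow> real"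
  assumes "liminf (\<lambda>n. ereal \<bar>h n - l\<bar>) = 0"
  shows "\<exists>r. strict_mono r \<and> (h \<circ> r) \<longlonglongrightarrow> l"
proof -
  obtain r where r: "strict_mono r" "((\<lambda>n. ereal \<bar>h n - l\<bar>) \<circ> r) \<longlonglongrightarrow> ereal 0"
    using liminf_subseq_lim[of "\<lambda>n. ereal \<bar>h n - l\<bar>"] assms by (auto simp: zero_ereal_def)
  then have "(\<lambda>n. \<bar>h (r n) - l\<bar>) \<longlonglongrightarrow> 0" by (simp add: o_def)
  then have "(h \<circ> r) \<longlonglongrightarrow> l"
    by (simp add: o_def LIM_zero_iff tendsto_rabs_zero_iff)
  with r show ?thesis by blast
qed

theorem theorem4p1:
  shows "(AE x in (lebesgue :: real measure).
            (\<lambda>n. s n x) \<sim>[sequentially] (\<lambda>n. real n / 2) \<and>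
            (\<lambda>n. s n x / real n) \<longlonglongrightarrow> 1 / 2) \<and>
         (\<exists>G :: real set.
            gdelta_in euclidean G \<and> closure G = UNIV \<and>
            (\<forall>x\<in>G.
               (\<exists>r. strict_mono r \<and>
                  ((\<lambda>n. s n x / real (prime_count n)) \<circ> r) \<longlonglongrightarrow> 1 / 2) \<and>
               liminf (\<lambda>n. ereal \<bar>s n x / real (prime_count n) - 1 / 2\<bar>) = 0))"
proof (intro conjI)
  show "AE x in (lebesgue :: real measure).
      (\<lambda>n. s n x) \<sim>[sequentially] (\<lambda>n. real n / 2) \<and>
      (\<lambda>n. s n x / real n) \<longlonglongrightarrow> 1 / 2"
    using AE_s_over_n
  proof eventually_elim
    case (elim x)
    have "(\<lambda>n. s n x / (real n / 2)) \<longlonglongrightarrow> 1"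
      using tendsto_mult_left[OF elim, of 2] by (simp add: mult.commute)
    then have "(\<lambda>n. s n x) \<sim>[sequentially] (\<lambda>n. real n / 2)"
      by (rule asymp_equivI')
    with elim show ?case by simp
  qed
next
  obtain G :: "real set" where G: "gdelta_in euclidean G" "closure G = UNIV"
      "\<And>x. x \<in> G \<Longrightarrow> liminf (\<lambda>n. ereal \<bar>s n x / real (prime_count n) - 1 / 2\<bar>) = 0"
    using exists_gdelta_dense_half_limit_point by blast
  then show "\<exists>G :: real set.
      gdelta_in euclidean G \<and> closure G = UNIV \<and>
      (\<forall>x\<in>G.
         (\<exists>r. strict_mono r \<and>
            ((\<lambda>n. s n x / real (prime_count n)) \<circ> r) \<longlonglongrightarrow> 1 / 2) \<and>
         liminf (\<lambda>n. ereal \<bar>s n x / real (prime_count n) - 1 / 2\<bar>) = 0)"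
    by (intro exI[of _ G]) (auto intro: strict_mono_subseq_tendsto_if_liminf_zero)
qed

end
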